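(* Let $1\le w<n$ be integers and let $F$ be the cumulative distribution function of a distribution on $[0,\infty)$ for which either there exists $\alpha$ with $F(\alpha)=\frac wn$, or $F$ is discrete, no such $\alpha$ exists, and the values $\alpha^-,\alpha^+$ of the context exist. Let $n$ players have costs drawn independently from $F$. Then the expected total payment of Mechanism 1 (as described in the context for buying $w$ data in expectation from these players) is 2-approximate to the envy-free benchmark, i.e. it is at most $2\,w\,E_{v\sim F}[v_{w+1}]$.
   Context: Setting: $n$ players, all with the same data type, each willing to sell one unit (his data) at private non-negative cost drawn independently from $F$ (costs are rescaled so that the privacy factor $\epsilon$ is $1$). $v_1\le v_2\le\dots\le v_n$ denote the costs in sorted order, so $v_{w+1}$ is the $(w+1)$-st smallest cost. Benchmark: $w\,E_{v\sim F}[v_{w+1}]$; this is a lower bound for the expected total payment of any dominant strategy truthful, ex-post individually rational, envy-free mechanism that always buys $w$ units. Mechanism 1 in this setting: (1) if there is $\alpha$ with $F(\alpha)=w/n$, each player is offered the price $\alpha$; a player accepts exactly when his cost is at most $\alpha$, an accepting player receives expected payment $\alpha$, and others receive $0$. (2) If there is no such $\alpha$ ($F$ discrete), let $\alpha^-$ be the largest value of the support (value of positive probability) with $F(\alpha^-)<w/n$ and $\alpha^+$ the smallest value of the support with $F(\alpha^+)>w/n$; put $c^-=F(\alpha^-)$, $c^+=F(\alpha^+)$, $\beta=\frac{w/n-c^-}{c^+-c^-}$. Each player is independently offered price $\alpha^+$ with probability $\beta$ and price $\alpha^-$ with probability $1-\beta$; a player accepts exactly when his cost is at most the offered price, an accepting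 player receives the offered price in expectation, and others receive $0$. *)

theory Defs
  imports "HOL-Probability.Probability"
begin

text \<open>The paper's distribution function \<open>F\<close> is \<open>cdf M\<close> for a distribution \<open>M\<close> on the reals; the
  cost profile of the players \<open>0, \<dots>, n - 1\<close> is drawn from the product measure.\<close>

definition cost_profiles :: "real measure \<Rightarrow> nat \<Rightarrow> (nat \<Rightarrow> real) measure" where
  "cost_profiles M n = Pi\<^sub>M {..<n} (\<lambda>_. M)"

text \<open>The index is 1-based: \<open>sorted_cost n 1 v\<close> is the smallest of \<open>v 0, \<dots>, v (n - 1)\<close>.\<close>

definition sorted_cost :: "nat \<Rightarrow> nat \<Rightarrow> (nat \<Rightarrow> real) \<Rightarrow> real" where
  "sorted_cost n k v = sort (map v [0..<n]) ! (k - 1)"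

text \<open>Expectations are nonnegative Lebesgue integrals, since the expectation of a sorted cost may be
  infinite.\<close>

definition envy_free_benchmark :: "real measure \<Rightarrow> nat \<Rightarrow> nat \<Rightarrow> ennreal" where
  "envy_free_benchmark M n w =
     of_nat w * (\<integral>\<^sup>+ v. ennreal (sorted_cost n (w + 1) v) \<partial>cost_profiles M n)"

definition discrete_distribution :: "real measure \<Rightarrow> bool" where
  "discrete_distribution M \<longleftrightarrow> (\<exists>S. countable S \<and> (AE x in M. x \<in> S))"

definition support_values :: "real measure \<Rightarrow> real set" where
  "support_values M = {x. measure M {x} > 0}"

definition is_alpha_minus :: "real measure \<Rightarrow> real \<Rightarrow> real \<Rightarrow> bool" where
  "is_alpha_minus M q a \<longleftrightarrow> a \<in> support_values M \<and> cdf M a < q \<and>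
     (\<forall>x\<in>support_values M. cdf M x < q \<longrightarrow> x \<le> a)"

definition is_alpha_plus :: "real measure \<Rightarrow> real \<Rightarrow> real \<Rightarrow> bool" where
  "is_alpha_plus M q b \<longleftrightarrow> b \<in> support_values M \<and> cdf M b > q \<and>
     (\<forall>x\<in>support_values M. cdf M x > q \<longrightarrow> b \<le> x)"

text \<open>\<open>mechanism1_offer M n w D\<close>: Mechanism 1 may draw the price offered to each single player
  from \<open>D\<close>. This is a relation because \<open>\<alpha>\<close> with \<open>F(\<alpha>) = w / n\<close> need not be unique.\<close>

inductive mechanism1_offer :: "real measure \<Rightarrow> nat \<Rightarrow> nat \<Rightarrow> real pmf \<Rightarrow> bool"
  for M :: "real measure" and n w :: nat where
  exact: "cdf M \<alpha> = real w / real n \<Longrightarrow> mechanism1_offer M n w (return_pmf \<alpha>)"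
| mixed: "\<lbrakk> \<nexists>\<alpha>. cdf M \<alpha> = real w / real n;
            is_alpha_minus M (real w / real n) a; is_alpha_plus M (real w / real n) b;
            \<beta> = (real w / real n - cdf M a) / (cdf M b - cdf M a) \<rbrakk> \<Longrightarrow>
          mechanism1_offer M n w (map_pmf (\<lambda>c. if c then b else a) (bernoulli_pmf \<beta>))"

text \<open>Payment to a player with cost \<open>c\<close> who is offered the price \<open>p\<close>, in expectation over any
  further randomness of the payment itself.\<close>

definition player_payment :: "real \<Rightarrow> real \<Rightarrow> real" where
  "player_payment p c = (if c \<le> p then p else 0)"

text \<open>Offers are independent across players and independent of the costs; \<open>0\<close> in \<open>Pi_pmf\<close> is the
  irrelevant value outside \<open>{..<n}\<close>.\<close>

definition expected_total_payment :: "real measure \<Rightarrow> nat \<Rightarrow> real pmf \<Rightarrow> ennreal" where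
  "expected_total_payment M n D =
     (\<integral>\<^sup>+ v. (\<integral>\<^sup>+ p. ennreal (\<Sum>i<n. player_payment (p i) (v i))
        \<partial>measure_pmf (Pi_pmf {..<n} 0 (\<lambda>_. D))) \<partial>cost_profiles M n)"

end

theory Submission
  imports Defs
begin

text \<open>Every price the mechanism offers lies in \<open>[0, c]\<close> and is accepted with average probability
  \<open>w / n\<close>, so the expected payment is at most \<open>w c\<close>; here \<open>c\<close> is \<open>\<alpha>\<close> or \<open>\<alpha>\<^sup>+\<close>.
  Let \<open>a\<close> be \<open>\<alpha>\<close> or \<open>\<alpha>\<^sup>-\<close>, respectively. Costs above \<open>a\<close> are almost surely at least \<open>c\<close>, so
  \<open>v\<^sub>w\<^sub>+\<^sub>1 \<ge> c\<close> whenever at most \<open>w\<close> costs are \<open>\<le> a\<close>. The number of such costs is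
  binomial with mean \<open>n F(a) \<le> w\<close>, and a binomial variable whose mean is at most the integer \<open>w\<close>
  is at most \<open>w\<close> with probability at least \<open>1 / 2\<close>.

  For this last fact, let \<open>p = w / n\<close> and let \<open>H x\<close> be the probability of at most \<open>w\<close> successes with
  success probability \<open>x\<close>. Its derivative is \<open>- C f x\<close> with \<open>f x = x\<^sup>w (1 - x)\<^sup>n\<^sup>-\<^sup>w\<^sup>-\<^sup>1\<close>.
  A decreasing involution \<open>\<sigma>\<close> with fixed point \<open>p\<close> for which \<open>H x + H (\<sigma> x)\<close> decreases as \<open>x\<close>
  moves away from \<open>p\<close>, ending at a value \<open>\<ge> 1\<close>, gives \<open>2 H p \<ge> 1\<close>. The reflection
  \<open>p + t \<mapsto> p - t\<close> has this property for \<open>p \<le> 1 / 2\<close>, and the inversion of the odds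
  \<open>x / (1 - x)\<close> at the odds of \<open>p\<close> has it for \<open>p \<ge> 1 / 2\<close>.\<close>

section \<open>The binomial lower tail and its derivative\<close>

text \<open>This is \<open>H\<close> from above as a polynomial in a real variable, so that it can
  be differentiated everywhere, including at 0 and 1.\<close>

definition binomial_lower_tail :: "nat \<Rightarrow> nat \<Rightarrow> real \<Rightarrow> real" where
  "binomial_lower_tail n w x = (\<Sum>k\<le>w. real (n choose k) * x ^ k * (1 - x) ^ (n - k))"


text \<open>The termwise derivatives telescope: the positive part of each one cancels the negative
  part of its predecessor by the absorption identity \<open>ch\<close>, and only the negative part
  of the last term survives.\<close>

lemma binomial_lower_tail_has_derivative:
  fixes n w :: nat and x :: real
  assumes "w < n"
  shows "(binomial_lower_tail n w has_real_derivative
           - (real (n - w) * real (n choose w) * (x ^ w * (1 - x) ^ (n - w - 1)))) (at x)"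
  using assms unfolding binomial_lower_tail_def[abs_def]
proof (induction w)
  case 0
  show ?case by (auto intro!: derivative_eq_intros)
next
  case (Suc w)
  have ch: "real (n choose Suc w) * (1 + real w) = real (n - w) * real (n choose w)"
    using binomial_absorb_comp[of n w] binomial_absorption[of w n] Suc.prems
    by (metis (no_types, lifting) Suc_eq_plus1_left mult.commute of_nat_mult of_nat_Suc binomial_absorption) 
  have "((\<lambda>x::real. x ^ Suc w) has_real_derivative (1 + real w) * x ^ w) (at x)"
    using DERIV_pow[of "Suc w" x] by simp
  moreover have "((\<lambda>x. (1 - x) ^ (n - Suc w)) has_real_derivative
      - (real (n - Suc w) * (1 - x) ^ (n - Suc w - 1))) (at x)"
    by (auto intro!: derivative_eq_intros)
  ultimately have "((\<lambda>x. real (n choose Suc w) * x ^ Suc w * (1 - x) ^ (n - Suc w)) has_real_derivative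
      real (n choose Suc w) * (1 + real w) * (x ^ w * (1 - x) ^ (n - w - 1))
      - real (n - Suc w) * real (n choose Suc w) * (x ^ Suc w * (1 - x) ^ (n - Suc w - 1))) (at x)"
    unfolding mult.assoc
    by (rule DERIV_cong[OF DERIV_cmult[OF DERIV_mult]]) (simp add: algebra_simps)
  from DERIV_add[OF Suc.IH this] Suc.prems show ?case
    by (simp add: ch)
qed

section \<open>The inequalities behind the two involutions\<close>

text \<open>The logarithm \<open>L\<close> of the ratio of the right side to the left side vanishes
  at 0 and is nondecreasing. Since \<open>m = q * w / p\<close>, the sign of its derivative is
  decided by \<open>u\<^sup>2 / (u\<^sup>2 - s\<^sup>2)\<close>, which decreases in
  \<open>u > s\<close>, at \<open>u = p\<close> and \<open>u = q\<close>. It is applied with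
  \<open>q = 1 - p\<close> and \<open>m = n - w\<close>.\<close>

lemma power_reflect_le:
  fixes p q t :: real and w m :: nat
  assumes "0 < p" "p \<le> q" "0 \<le> t" "t < p" "p * real m = q * real w"
  shows "(p - t) ^ w * (q + t) ^ m \<le> (p + t) ^ w * (q - t) ^ m"
proof -
  define L where "L = (\<lambda>t. real w * (ln (p + t) - ln (p - t)) + real m * (ln (q - t) - ln (q + t)))"
  have "L 0 \<le> L t"
  proof (rule DERIV_nonneg_imp_nondecreasing[OF \<open>0 \<le> t\<close>])
    fix s assume s: "0 \<le> s" "s \<le> t"
    have "(L has_real_derivative real w * (1 / (p + s) + 1 / (p - s)) - real m * (1 / (q - s) + 1 / (q + s))) (at s)"
      unfolding L_def using s assms by (auto intro!: derivative_eq_intros simp: algebra_simps)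
    moreover have "real m * (1 / (q - s) + 1 / (q + s)) \<le> real w * (1 / (p + s) + 1 / (p - s))"
    proof -
      have "s\<^sup>2 < p\<^sup>2" "p\<^sup>2 \<le> q\<^sup>2" using s assms by (auto intro!: power_strict_mono power_mono)
      have m: "real m = q * real w / p" using assms by (simp add: field_simps)
      have "real m * (1 / (q - s) + 1 / (q + s)) = real m * (2 * q / (q\<^sup>2 - s\<^sup>2))"
        using s assms by (simp add: field_simps power2_eq_square)
      also have "\<dots> = (2 * real w / p) * (q\<^sup>2 / (q\<^sup>2 - s\<^sup>2))"
        using m by (simp add: power2_eq_square)
      also have "\<dots> \<le> (2 * real w / p) * (p\<^sup>2 / (p\<^sup>2 - s\<^sup>2))"
      proof (intro mult_left_mono)
        have "0 < p\<^sup>2 - s\<^sup>2" "0 < q\<^sup>2 - s\<^sup>2" using \<open>s\<^sup>2 < p\<^sup>2\<close> \<open>p\<^sup>2 \<le> q\<^sup>2\<close> by auto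
        moreover have "q\<^sup>2 * (p\<^sup>2 - s\<^sup>2) \<le> p\<^sup>2 * (q\<^sup>2 - s\<^sup>2)"
          using mult_right_mono[OF \<open>p\<^sup>2 \<le> q\<^sup>2\<close>, of "s\<^sup>2"] by (simp add: algebra_simps)
        ultimately show "q\<^sup>2 / (q\<^sup>2 - s\<^sup>2) \<le> p\<^sup>2 / (p\<^sup>2 - s\<^sup>2)"
          by (simp add: frac_le_eq divide_le_0_iff)
      qed (use assms in simp)
      also have "\<dots> = real w * (1 / (p + s) + 1 / (p - s))"
        using s assms \<open>s\<^sup>2 < p\<^sup>2\<close> by (simp add: divide_simps) (simp add: algebra_simps power2_eq_square)
      finally show ?thesis .
    qed
    ultimately show "\<exists>y. (L has_real_derivative y) (at s) \<and> 0 \<le> y" by force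
  qed
  moreover have "L 0 = 0" by (simp add: L_def)
  ultimately have "ln ((p - t) ^ w * (q + t) ^ m) \<le> ln ((p + t) ^ w * (q - t) ^ m)"
    using assms by (simp add: L_def ln_mult ln_realpow algebra_simps)
  then show ?thesis using assms by simp
qed

text \<open>Here \<open>r\<close> stands for the inverted odds \<open>(1 - x) / x\<close>, and
  \<open>m / w\<close> is their value at the mean. Up to constants, \<open>L\<close> is the
  logarithm of the ratio of the two sides; it increases up to \<open>m / w\<close>, where equality
  holds.\<close>

lemma odds_reflect_le:
  fixes w m :: nat and r :: real
  assumes "0 < m" "m \<le> w" "0 < r" "r \<le> real m / real w"
  shows "real w ^ (2 * w + 2) * real m ^ (2 * m) * r ^ (w - m + 1) * (1 + r) ^ (w + m + 1)
         \<le> ((real w)\<^sup>2 * r + (real m)\<^sup>2) ^ (w + m + 1)"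
proof -
  define W where "W = real w"
  define K where "K = real m"
  have WK: "0 < K" "K \<le> W" "0 < W" using assms by (auto simp: W_def K_def)
  define L where "L = (\<lambda>r. (W - K + 1) * ln r + (W + K + 1) * ln (1 + r) - (W + K + 1) * ln (W\<^sup>2 * r + K\<^sup>2))"
  have "L r \<le> L (K / W)"
  proof (rule DERIV_nonneg_imp_nondecreasing[where f = L and a = r and b = "K / W"])
    show "r \<le> K / W" using assms by (simp add: W_def K_def)
    fix s assume s: "r \<le> s" "s \<le> K / W"
    then have "0 < s" using assms by simp
    have pos: "0 < W\<^sup>2 * s + K\<^sup>2" using WK \<open>0 < s\<close> by (simp add: add_pos_pos)
    let ?D = "(W - K + 1) / s + (W + K + 1) / (1 + s) - (W + K + 1) * W\<^sup>2 / (W\<^sup>2 * s + K\<^sup>2)"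
    have "(L has_real_derivative ?D) (at s)"
      unfolding L_def using \<open>0 < s\<close> pos by (auto intro!: derivative_eq_intros)
    moreover have "0 \<le> ?D"
    proof -
      let ?d = "(1 + s) * (W\<^sup>2 * s + K\<^sup>2)"
      have dpos: "0 < ?d" using pos \<open>0 < s\<close> by simp
      \<comment> \<open>The right side exceeds the left side by the square of
        \<open>W * s - K\<close>.\<close>
      have "(W + K)\<^sup>2 * s \<le> ?d"
        using zero_le_square[of "W * s - K"] by (simp add: algebra_simps power2_eq_square)
      then have "(W - K) * ((W + K)\<^sup>2 * s) \<le> (W - K) * ?d"
        using WK by (intro mult_left_mono) auto
      then have "(W + K) * ((W\<^sup>2 - K\<^sup>2) * s) \<le> (W - K) * ?d"
        by (simp add: algebra_simps power2_eq_square)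
      then have 1: "(W\<^sup>2 - K\<^sup>2) * s / ?d \<le> (W - K) / (W + K)"
        using dpos WK by (simp add: divide_simps) (simp add: algebra_simps)
      \<comment> \<open>This product is what \<open>?D * s\<close> subtracts from
        \<open>W - K + 1\<close>. The \<open>+ 1\<close> there absorbs the remainder
        \<open>(W - K) / (W + K)\<close>, which is at most 1.\<close>
      have "(W + K + 1) * ((W\<^sup>2 - K\<^sup>2) * s / ?d) \<le> (W + K + 1) * ((W - K) / (W + K))"
        using 1 WK by (intro mult_left_mono) auto
      also have "\<dots> = (W - K) + (W - K) / (W + K)"
        using WK by (simp add: field_simps)
      also have "\<dots> \<le> W - K + 1"
        using WK by (simp add: field_simps)
      finally have "0 \<le> (W - K + 1 - (W + K + 1) * ((W\<^sup>2 - K\<^sup>2) * s / ?d)) / s"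
        using \<open>0 < s\<close> by simp
      also have "\<dots> = ?D"
      proof -
        have "1 / (1 + s) - W\<^sup>2 / (W\<^sup>2 * s + K\<^sup>2) = - (W\<^sup>2 - K\<^sup>2) / ?d"
          using \<open>0 < s\<close> pos dpos by (simp add: divide_simps) (simp add: algebra_simps)
        then have "(W + K + 1) * (1 / (1 + s) - W\<^sup>2 / (W\<^sup>2 * s + K\<^sup>2)) = (W + K + 1) * (- (W\<^sup>2 - K\<^sup>2) / ?d)"
          by simp
        then show ?thesis using \<open>0 < s\<close> by (simp add: diff_divide_distrib right_diff_distrib)
      qed
      finally show ?thesis .
    qed
    ultimately show "\<exists>y. (L has_real_derivative y) (at s) \<and> 0 \<le> y" by blast
  qed
  \<comment> \<open>The value is minus the logarithm of the constant factor of the claim: this is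
    the case of equality.\<close>
  also have "L (K / W) = - ((2 * W + 2) * ln W + 2 * K * ln K)"
  proof -
    have "W\<^sup>2 * (K / W) + K\<^sup>2 = K * (W + K)" "1 + K / W = (W + K) / W"
      using WK by (simp_all add: field_simps power2_eq_square)
    moreover have "ln (K * (W + K)) = ln K + ln (W + K)" "ln ((W + K) / W) = ln (W + K) - ln W"
      "ln (K / W) = ln K - ln W"
      using WK by (simp_all add: ln_mult ln_div)
    ultimately show ?thesis
      unfolding L_def by (simp only:) (simp add: algebra_simps)
  qed
  finally have L: "L r \<le> - ((2 * W + 2) * ln W + 2 * K * ln K)" .
  have pos: "0 < W\<^sup>2 * r + K\<^sup>2" "0 < 1 + r" using WK \<open>0 < r\<close> by (simp_all add: add_pos_pos)
  have "real (w - m + 1) = W - K + 1" "real (w + m + 1) = W + K + 1" "real (2 * w + 2) = 2 * W + 2" "real (2 * m) = 2 * K"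
    using assms by (auto simp: W_def K_def)
  then have "ln (W ^ (2 * w + 2) * K ^ (2 * m) * r ^ (w - m + 1) * (1 + r) ^ (w + m + 1))
      \<le> ln ((W\<^sup>2 * r + K\<^sup>2) ^ (w + m + 1))"
    using L WK pos \<open>0 < r\<close> by (simp only: ln_mult_pos ln_realpow zero_less_power mult_pos_pos L_def)
  then show ?thesis using WK pos \<open>0 < r\<close> by (simp add: W_def K_def)
qed

section \<open>The binomial tail at the mean is at least one half\<close>

lemma binomial_lower_tail_nonneg: "0 \<le> x \<Longrightarrow> x \<le> 1 \<Longrightarrow> 0 \<le> binomial_lower_tail n w x"
  by (simp add: binomial_lower_tail_def sum_nonneg)

lemma binomial_lower_tail_0 [simp]: "binomial_lower_tail n w 0 = 1"
proof -
  have "binomial_lower_tail n w 0 = (\<Sum>k\<le>w. if k = 0 then 1 else 0)"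
    unfolding binomial_lower_tail_def by (intro sum.cong) (auto simp: power_0_left)
  then show ?thesis by (simp add: sum.delta)
qed

lemma binomial_lower_tail_1 [simp]: "w < n \<Longrightarrow> binomial_lower_tail n w 1 = 0"
  unfolding binomial_lower_tail_def by (intro sum.neutral) (auto simp: power_0_left)

lemma binomial_lower_tail_antimono:
  assumes "w < n" "0 \<le> x" "x \<le> y" "y \<le> 1"
  shows "binomial_lower_tail n w y \<le> binomial_lower_tail n w x"
proof (rule DERIV_nonpos_imp_nonincreasing[OF \<open>x \<le> y\<close>])
  fix z assume "x \<le> z" "z \<le> y"
  then show "\<exists>d. (binomial_lower_tail n w has_real_derivative d) (at z) \<and> d \<le> 0"
    using binomial_lower_tail_has_derivative[OF \<open>w < n\<close>, of z] assms by force
qed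

lemma binomial_lower_tail_mean_small:
  assumes "0 < w" "2 * w \<le> n"
  shows "1 / 2 \<le> binomial_lower_tail n w (real w / real n)"
proof -
  define p where "p = real w / real n"
  define q where "q = 1 - p"
  let ?C = "real (n - w) * real (n choose w)"
  let ?f = "\<lambda>x::real. x ^ w * (1 - x) ^ (n - w - 1)"
  let ?\<Phi> = "\<lambda>t. binomial_lower_tail n w (p - t) + binomial_lower_tail n w (p + t)"
  have "w < n" using assms by simp
  have "real w + real w \<le> real n" using assms by linarith
  then have p: "0 < p" "p \<le> q" "p * real (n - w) = q * real w" "2 * p \<le> 1"
    using assms by (auto simp: p_def q_def field_simps of_nat_diff)
  have f_le: "?f (p - t) \<le> ?f (p + t)" if "0 \<le> t" "t \<le> p" for t
  proof (cases "t = p")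
    case True
    then show ?thesis using assms p by (simp add: power_0_left)
  next
    case False
    with that have "t < p" by simp
    then have qt: "0 < q - t" "q - t \<le> q + t" using p that by auto
    have e: "n - w = Suc (n - w - 1)" using \<open>w < n\<close> by simp
    \<comment> \<open>\<open>power_reflect_le\<close> has the exponent \<open>n - w\<close>, one
      more than \<open>?f\<close>. The missing factors are \<open>q + t\<close> on the left and the
      smaller \<open>q - t\<close> on the right, so the latter can be cancelled.\<close>
    have "?f (p - t) * (q - t) \<le> ?f (p - t) * (q + t)"
      using qt p \<open>t < p\<close> by (intro mult_left_mono) (auto simp: q_def)
    also have "\<dots> = (p - t) ^ w * (q + t) ^ (n - w)"
      by (subst e) (simp add: q_def algebra_simps)
    also have "\<dots> \<le> (p + t) ^ w * (q - t) ^ (n - w)"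
      using p that \<open>t < p\<close> by (intro power_reflect_le)
    also have "\<dots> = ?f (p + t) * (q - t)"
      by (subst e) (simp add: q_def algebra_simps)
    finally show ?thesis using qt by simp
  qed
  \<comment> \<open>The right end is twice the tail at \<open>p\<close>. The left end is 1 plus the
    tail at \<open>2 * p\<close>, which is nonnegative because \<open>2 * p \<le> 1\<close>.\<close>
  have "?\<Phi> p \<le> ?\<Phi> 0"
  proof (rule DERIV_nonpos_imp_nonincreasing[where f = ?\<Phi>])
    fix t assume t: "0 \<le> t" "t \<le> p"
    have "(?\<Phi> has_real_derivative ?C * (?f (p - t) - ?f (p + t))) (at t)"
      by (rule DERIV_cong[OF DERIV_add[OF
            DERIV_chain2[OF binomial_lower_tail_has_derivative[OF \<open>w < n\<close>], where g = "\<lambda>t. p - t" and Db = "-1"]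
            DERIV_chain2[OF binomial_lower_tail_has_derivative[OF \<open>w < n\<close>], where g = "\<lambda>t. p + t" and Db = 1]]])
         (auto intro!: derivative_eq_intros simp: right_diff_distrib)
    moreover have "?C * (?f (p - t) - ?f (p + t)) \<le> 0"
      using f_le[OF t] by (intro mult_nonneg_nonpos) auto
    ultimately show "\<exists>d. (?\<Phi> has_real_derivative d) (at t) \<and> d \<le> 0" by blast
  qed (use p in simp)
  moreover have "0 \<le> binomial_lower_tail n w (p + p)"
    using p by (intro binomial_lower_tail_nonneg) auto
  ultimately show ?thesis by (simp add: p_def)
qed

text \<open>This is \<open>odds_reflect_le\<close> at \<open>r = (1 - x) / x\<close> with
  denominators cleared; the total power of \<open>x\<close> multiplied in is
  \<open>(w - m + 1) + (w + m + 1)\<close>.\<close>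

lemma prob_reflect_le:
  fixes w m :: nat and x :: real
  assumes "0 < m" "m \<le> w" "real w / real (w + m) \<le> x" "x < 1"
  shows "real w ^ (2 * w + 2) * real m ^ (2 * m) * (1 - x) ^ (w - m + 1)
         \<le> x ^ (w - m + 1) * ((real w)\<^sup>2 * (1 - x) + (real m)\<^sup>2 * x) ^ (w + m + 1)"
proof -
  have "0 < x" using assms by (smt (verit) divide_pos_pos of_nat_0_less_iff add_pos_pos le_eq_less_or_eq less_trans)
  define r where "r = (1 - x) / x"
  have "real w \<le> x * (real w + real m)" using assms by (simp add: field_simps)
  then have "0 < r" "r \<le> real m / real w"
    using assms \<open>0 < x\<close> by (auto simp: r_def field_simps)
  from odds_reflect_le[OF assms(1,2) this]
  have "real w ^ (2 * w + 2) * real m ^ (2 * m) * r ^ (w - m + 1) * (1 + r) ^ (w + m + 1) * (x ^ (w - m + 1) * x ^ (w + m + 1))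
         \<le> ((real w)\<^sup>2 * r + (real m)\<^sup>2) ^ (w + m + 1) * (x ^ (w - m + 1) * x ^ (w + m + 1))"
    using \<open>0 < x\<close> by (intro mult_right_mono) auto
  then have "real w ^ (2 * w + 2) * real m ^ (2 * m) * (r * x) ^ (w - m + 1) * ((1 + r) * x) ^ (w + m + 1)
         \<le> x ^ (w - m + 1) * (((real w)\<^sup>2 * r + (real m)\<^sup>2) * x) ^ (w + m + 1)"
    unfolding power_mult_distrib by (simp only: mult_ac)
  moreover have "r * x = 1 - x" "(1 + r) * x = 1"
    "((real w)\<^sup>2 * r + (real m)\<^sup>2) * x = (real w)\<^sup>2 * (1 - x) + (real m)\<^sup>2 * x"
    using \<open>0 < x\<close> by (simp_all add: r_def field_simps)
  ultimately show ?thesis by simp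
qed

lemma binomial_lower_tail_mean_large:
  assumes "w < n" "n \<le> 2 * w"
  shows "1 / 2 \<le> binomial_lower_tail n w (real w / real n)"
proof -
  define m where "m = n - w"
  have m: "0 < m" "m \<le> w" "n = w + m" using assms by (auto simp: m_def)
  define W where "W = real w"
  define K where "K = real m"
  have WK: "0 < W" "0 < K" using m by (auto simp: W_def K_def)
  define p where "p = real w / real n"
  have p: "0 < p" "p < 1" "p = W / (W + K)" using assms m by (auto simp: p_def W_def K_def)
  \<comment> \<open>The odds of \<open>\<sigma> x\<close> are \<open>(W / K)\<^sup>2\<close> divided
    by the odds of \<open>x\<close>, and \<open>W / K\<close> are the odds of \<open>p\<close>;
    \<open>s\<close> is the normalising denominator.\<close>
  define s where "s = (\<lambda>x. W\<^sup>2 * (1 - x) + K\<^sup>2 * x)"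
  define \<sigma> where "\<sigma> = (\<lambda>x. W\<^sup>2 * (1 - x) / s x)"
  let ?C = "real (n - w) * real (n choose w)"
  let ?f = "\<lambda>x::real. x ^ w * (1 - x) ^ (n - w - 1)"
  let ?\<Phi> = "\<lambda>x. binomial_lower_tail n w x + binomial_lower_tail n w (\<sigma> x)"
  have s_pos: "0 < s x" if "p \<le> x" "x \<le> 1" for x
    using that p(1) WK unfolding s_def by (intro add_nonneg_pos) auto
  \<comment> \<open>The extra factor is minus the derivative of \<open>\<sigma>\<close>, as computed
    below. Once the common powers of \<open>x\<close> and \<open>1 - x\<close> with exponent
    \<open>m - 1\<close> are split off, \<open>prob_reflect_le\<close> remains. The endpoint
    \<open>x = 1\<close>, excluded there, is trivial because \<open>\<sigma> 1 = 0\<close> and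
    \<open>w > 0\<close>.\<close>
  have f_le: "?f (\<sigma> x) * (W\<^sup>2 * K\<^sup>2 / (s x)\<^sup>2) \<le> ?f x" if x: "p \<le> x" "x \<le> 1" for x
  proof (cases "x = 1")
    case True
    then show ?thesis using m by (simp add: \<sigma>_def power_0_left)
  next
    case False
    with x have "x < 1" by simp
    have "0 < x" using x p by simp
    note s = s_pos[OF x]
    have e: "n - w - 1 = m - 1" "w = (w - m + 1) + (m - 1)" "2 * m = (m - 1) + (m - 1) + 2" using m by auto
    have "1 - \<sigma> x = K\<^sup>2 * x / s x" using s by (simp add: \<sigma>_def s_def field_simps)
    then have "?f (\<sigma> x) * (W\<^sup>2 * K\<^sup>2 / (s x)\<^sup>2)
        = (W\<^sup>2 * (1 - x)) ^ w * (K\<^sup>2 * x) ^ (m - 1) * (W\<^sup>2 * K\<^sup>2) / (s x ^ w * s x ^ (m - 1) * (s x)\<^sup>2)"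
      unfolding e(1) by (simp add: \<sigma>_def power_divide)
    also have "s x ^ w * s x ^ (m - 1) * (s x)\<^sup>2 = s x ^ (w + m + 1)"
      using m by (simp flip: power_add)
    also have "(W\<^sup>2 * (1 - x)) ^ w * (K\<^sup>2 * x) ^ (m - 1) * (W\<^sup>2 * K\<^sup>2)
        = ((W\<^sup>2) ^ w * W\<^sup>2) * ((K\<^sup>2) ^ (m - 1) * K\<^sup>2) * (1 - x) ^ w * x ^ (m - 1)"
      by (simp only: power_mult_distrib mult_ac)
    also have "(W\<^sup>2) ^ w * W\<^sup>2 = W ^ (2 * w + 2)" by (simp only: power_mult power_add)
    also have "(K\<^sup>2) ^ (m - 1) * K\<^sup>2 = K ^ (2 * m)"
      unfolding power_mult[symmetric] power_add[symmetric] using m by (intro arg_cong[where f = "power K"]) simp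
    also have "(1 - x) ^ w = (1 - x) ^ (w - m + 1) * (1 - x) ^ (m - 1)"
      by (subst e(2)) (rule power_add)
    also have "W ^ (2 * w + 2) * K ^ (2 * m) * ((1 - x) ^ (w - m + 1) * (1 - x) ^ (m - 1)) * x ^ (m - 1) / s x ^ (w + m + 1)
        = W ^ (2 * w + 2) * K ^ (2 * m) * (1 - x) ^ (w - m + 1) * ((1 - x) ^ (m - 1) * x ^ (m - 1) / s x ^ (w + m + 1))"
      by simp
    also have "\<dots> \<le> x ^ (w - m + 1) * s x ^ (w + m + 1) * ((1 - x) ^ (m - 1) * x ^ (m - 1) / s x ^ (w + m + 1))"
      using prob_reflect_le[OF m(1,2), of x] x \<open>x < 1\<close> \<open>0 < x\<close> s m
      by (intro mult_right_mono) (auto simp: s_def W_def K_def p_def)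
    also have "\<dots> = x ^ (w - m + 1) * x ^ (m - 1) * (1 - x) ^ (m - 1)"
      using s by simp
    also have "\<dots> = ?f x"
      unfolding power_add[symmetric] e(1) e(2)[symmetric] ..
    finally show ?thesis .
  qed
  \<comment> \<open>As \<open>\<sigma>\<close> swaps 0 and 1 and fixes \<open>p\<close>, the left
    end is 0 + 1 and the right end is twice the tail at \<open>p\<close>.\<close>
  have "?\<Phi> 1 \<le> ?\<Phi> p"
  proof (rule DERIV_nonpos_imp_nonincreasing[where f = ?\<Phi>])
    fix x assume x: "p \<le> x" "x \<le> 1"
    note s = s_pos[OF x]
    let ?D = "(W\<^sup>2 * (0 - 1) * s x - W\<^sup>2 * (1 - x) * (W\<^sup>2 * (0 - 1) + K\<^sup>2)) / (s x * s x)"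
    have "(\<sigma> has_real_derivative ?D) (at x)"
      using s unfolding \<sigma>_def s_def by (auto intro!: derivative_eq_intros)
    moreover have "W\<^sup>2 * (0 - 1) * s x - W\<^sup>2 * (1 - x) * (W\<^sup>2 * (0 - 1) + K\<^sup>2) = - (W\<^sup>2 * K\<^sup>2)"
      by (simp add: s_def algebra_simps)
    ultimately have "(\<sigma> has_real_derivative - (W\<^sup>2 * K\<^sup>2 / (s x)\<^sup>2)) (at x)"
      by (simp add: power2_eq_square)
    then have "(?\<Phi> has_real_derivative - (?C * ?f x) + - (?C * ?f (\<sigma> x)) * - (W\<^sup>2 * K\<^sup>2 / (s x)\<^sup>2)) (at x)"
      by (intro DERIV_add DERIV_chain2[where g = \<sigma>] binomial_lower_tail_has_derivative \<open>w < n\<close>)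
    moreover have "- (?C * ?f x) + - (?C * ?f (\<sigma> x)) * - (W\<^sup>2 * K\<^sup>2 / (s x)\<^sup>2)
        = ?C * (?f (\<sigma> x) * (W\<^sup>2 * K\<^sup>2 / (s x)\<^sup>2) - ?f x)"
      by (simp add: right_diff_distrib)
    moreover have "\<dots> \<le> 0"
      using f_le[OF x] by (intro mult_nonneg_nonpos) auto
    ultimately show "\<exists>d. (?\<Phi> has_real_derivative d) (at x) \<and> d \<le> 0" by metis
  qed (use p in simp)
  moreover have "\<sigma> p = p"
  proof -
    have "1 - p = K / (W + K)" using WK p(3) by (simp add: field_simps)
    moreover from this have "s p = (W\<^sup>2 * K + K\<^sup>2 * W) / (W + K)"
      using p(3) by (simp add: s_def add_divide_distrib)
    moreover have "W\<^sup>2 * K + K\<^sup>2 * W = W * K * (W + K)"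
      by (simp add: algebra_simps power2_eq_square)
    ultimately show ?thesis
      using WK p(3) by (simp add: \<sigma>_def power2_eq_square)
  qed
  moreover have "\<sigma> 1 = 0" by (simp add: \<sigma>_def)
  ultimately show ?thesis using \<open>w < n\<close> by (simp add: p_def)
qed

lemma binomial_lower_tail_ge_half:
  assumes "w < n" "0 \<le> p" "p \<le> real w / real n"
  shows "1 / 2 \<le> binomial_lower_tail n w p"
proof -
  have "1 / 2 \<le> binomial_lower_tail n w (real w / real n)"
  proof (cases "w = 0")
    case False
    then show ?thesis
      using assms binomial_lower_tail_mean_small[of w n] binomial_lower_tail_mean_large[of w n]
      by linarith
  qed simp
  also have "\<dots> \<le> binomial_lower_tail n w p"
    using assms by (intro binomial_lower_tail_antimono) auto
  finally show ?thesis .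
qed

section \<open>The benchmark from below: counting cheap costs\<close>

text \<open>The event is the disjoint union of the boxes \<open>B A\<close>, where \<open>A\<close>
  is the exact set of indices landing in \<open>S\<close>. Independence gives the probability of
  each box, and grouping by \<open>card A\<close> yields the binomial coefficients.\<close>

lemma prob_card_le_eq_binomial_lower_tail:
  assumes "prob_space M" and "S \<in> sets M" and "finite I"
  shows "measure (Pi\<^sub>M I (\<lambda>_. M)) {v \<in> space (Pi\<^sub>M I (\<lambda>_. M)). card {i \<in> I. v i \<in> S} \<le> w}
         = binomial_lower_tail (card I) w (measure M S)" (is "measure ?P ?E = _")
    and "{v \<in> space (Pi\<^sub>M I (\<lambda>_. M)). card {i \<in> I. v i \<in> S} \<le> w} \<in> sets (Pi\<^sub>M I (\<lambda>_. M))"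
proof -
  interpret prob_space M by fact
  interpret P: finite_product_prob_space "\<lambda>_. M" I by unfold_locales fact
  define B where "B = (\<lambda>A. \<Pi>\<^sub>E i\<in>I. if i \<in> A then S else space M - S)"
  define \<A> where "\<A> = {A. A \<subseteq> I \<and> card A \<le> w}"
  have "finite \<A>" using \<open>finite I\<close> unfolding \<A>_def by (auto intro: finite_subset[of _ "Pow I"])
  have mem_B: "v \<in> B A \<longleftrightarrow> v \<in> space ?P \<and> {i \<in> I. v i \<in> S} = A" if "A \<subseteq> I" for v A
    using that sets.sets_into_space[OF \<open>S \<in> sets M\<close>]
    by (auto simp: B_def space_PiM PiE_iff split: if_splits)
  have E: "?E = (\<Union>A\<in>\<A>. B A)"
  proof (intro equalityI subsetI)
    fix v assume "v \<in> ?E"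
    then show "v \<in> (\<Union>A\<in>\<A>. B A)"
      using mem_B[of "{i \<in> I. v i \<in> S}" v] by (intro UN_I[of "{i \<in> I. v i \<in> S}"]) (auto simp: \<A>_def)
  qed (auto simp: \<A>_def mem_B)
  have B_sets: "B A \<in> sets ?P" for A
    unfolding B_def using assms by (intro sets_PiM_I_finite) auto
  show "?E \<in> sets ?P" unfolding E using \<open>finite \<A>\<close> B_sets by blast
  have "disjoint_family_on B \<A>"
    by (auto simp: disjoint_family_on_def \<A>_def mem_B)
  then have "measure ?P ?E = (\<Sum>A\<in>\<A>. measure ?P (B A))"
    unfolding E using B_sets \<open>finite \<A>\<close> by (intro P.finite_measure_finite_Union) auto
  also have "\<dots> = (\<Sum>A\<in>\<A>. prob S ^ card A * (1 - prob S) ^ (card I - card A))"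
  proof (rule sum.cong[OF refl])
    fix A assume "A \<in> \<A>"
    then have "A \<subseteq> I" by (simp add: \<A>_def)
    have "measure ?P (B A) = (\<Prod>i\<in>I. prob (if i \<in> A then S else space M - S))"
      unfolding B_def using assms by (intro P.prob_times) auto
    also have "\<dots> = (\<Prod>i\<in>I. if i \<in> A then prob S else 1 - prob S)"
      by (intro prod.cong refl) (simp add: prob_compl[OF assms(2)])
    also have "\<dots> = prob S ^ card A * (1 - prob S) ^ card (I - A)"
      using \<open>finite I\<close> \<open>A \<subseteq> I\<close> by (simp add: prod.If_cases Int_absorb1 flip: Diff_eq)
    finally show "measure ?P (B A) = prob S ^ card A * (1 - prob S) ^ (card I - card A)"
      using \<open>finite I\<close> \<open>A \<subseteq> I\<close> by (simp add: card_Diff_subset finite_subset)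
  qed
  also have "\<dots> = (\<Sum>k\<le>w. \<Sum>A\<in>{A \<in> \<A>. card A = k}. prob S ^ card A * (1 - prob S) ^ (card I - card A))"
    by (rule sum.group[symmetric, OF \<open>finite \<A>\<close>]) (auto simp: \<A>_def)
  also have "\<dots> = (\<Sum>k\<le>w. real (card {A. A \<subseteq> I \<and> card A = k}) * (prob S ^ k * (1 - prob S) ^ (card I - k)))"
  proof (rule sum.cong[OF refl])
    fix k assume "k \<in> {..w}"
    then have "{A \<in> \<A>. card A = k} = {A. A \<subseteq> I \<and> card A = k}" by (auto simp: \<A>_def)
    then show "(\<Sum>A\<in>{A \<in> \<A>. card A = k}. prob S ^ card A * (1 - prob S) ^ (card I - card A))
      = real (card {A. A \<subseteq> I \<and> card A = k}) * (prob S ^ k * (1 - prob S) ^ (card I - k))"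
      by simp
  qed
  also have "\<dots> = binomial_lower_tail (card I) w (prob S)"
    by (simp add: n_subsets[OF \<open>finite I\<close>] binomial_lower_tail_def mult.assoc)
  finally show "measure ?P ?E = binomial_lower_tail (card I) w (prob S)" .
qed

text \<open>The 0-based position is \<open>w\<close>: if that entry were at most \<open>a\<close>,
  so would be the \<open>w + 1\<close> entries up to it, and sorting preserves the number of entries
  at most \<open>a\<close>.\<close>

lemma sorted_cost_greater:
  assumes "w < n" and "card {i \<in> {..<n}. v i \<le> a} \<le> w"
  shows "a < sorted_cost n (w + 1) v"
proof (rule ccontr)
  define ys where "ys = map v [0..<n]"
  assume "\<not> a < sorted_cost n (w + 1) v"
  then have "sort ys ! w \<le> a" by (simp add: sorted_cost_def ys_def)
  moreover have "sort ys ! j \<le> sort ys ! w" if "j \<le> w" for j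
    using that \<open>w < n\<close> by (intro sorted_nth_mono) (auto simp: ys_def)
  ultimately have "{..w} \<subseteq> {j. j < length (sort ys) \<and> sort ys ! j \<le> a}"
    using \<open>w < n\<close> by (force simp: ys_def)
  then have "card {..w} \<le> length (filter (\<lambda>x. x \<le> a) (sort ys))"
    unfolding length_filter_conv_card by (intro card_mono) auto
  also have "\<dots> = length (filter (\<lambda>x. x \<le> a) ys)"
    by (metis filter_sort length_sort)
  also have "\<dots> = card {i \<in> {..<n}. v i \<le> a}"
    unfolding length_filter_conv_card by (intro arg_cong[where f = card]) (auto simp: ys_def)
  finally show False using assms by simp
qed

text \<open>Transfers almost sure facts about each single cost to the order statistic.\<close>

lemma sorted_cost_in_image:
  assumes "w < n"
  shows "sorted_cost n (w + 1) v \<in> v ` {..<n}"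
proof -
  have "sort (map v [0..<n]) ! w \<in> set (sort (map v [0..<n]))"
    using assms by (intro nth_mem) simp
  then show ?thesis by (simp add: sorted_cost_def lessThan_atLeast0)
qed

text \<open>A Markov-type bound. The two thresholds \<open>a\<close> and \<open>c\<close> allow for
  a gap between consecutive atoms; without a gap they coincide.\<close>

lemma expected_sorted_cost_ge:
  assumes "real_distribution M" and "w < n" and "0 \<le> c" and "AE x in M. a < x \<longrightarrow> c \<le> x"
  shows "ennreal (c * binomial_lower_tail n w (cdf M a))
         \<le> (\<integral>\<^sup>+ v. ennreal (sorted_cost n (w + 1) v) \<partial>cost_profiles M n)"
proof -
  interpret real_distribution M by fact
  let ?P = "Pi\<^sub>M {..<n} (\<lambda>_. M)"
  interpret P: prob_space ?P by (rule prob_space_PiM) (rule prob_space_axioms)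
  let ?E = "{v \<in> space ?P. card {i \<in> {..<n}. v i \<in> {..a}} \<le> w}"
  have "{..a} \<in> sets M" by simp
  note E = prob_card_le_eq_binomial_lower_tail[OF prob_space_axioms this, of "{..<n}" w, simplified card_lessThan]
  have "AE v in ?P. \<forall>i\<in>{..<n}. a < v i \<longrightarrow> c \<le> v i"
    using assms(4) by (intro AE_finite_allI AE_PiM_component prob_space_axioms) auto
  then have "AE v in ?P. ennreal c * indicator ?E v \<le> ennreal (sorted_cost n (w + 1) v)"
  proof eventually_elim
    case (elim v)
    obtain i where "i < n" "sorted_cost n (w + 1) v = v i"
      using sorted_cost_in_image[OF \<open>w < n\<close>, of v] by auto
    then show ?case
      using elim sorted_cost_greater[OF \<open>w < n\<close>, of v a]
      by (auto simp: indicator_def intro!: ennreal_leI)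
  qed
  then have "(\<integral>\<^sup>+ v. ennreal c * indicator ?E v \<partial>?P) \<le> (\<integral>\<^sup>+ v. ennreal (sorted_cost n (w + 1) v) \<partial>?P)"
    by (rule nn_integral_mono_AE)
  moreover have "(\<integral>\<^sup>+ v. ennreal c * indicator ?E v \<partial>?P) = ennreal c * emeasure ?P ?E"
    using E(2) by (intro nn_integral_cmult_indicator) simp
  moreover have "emeasure ?P ?E = ennreal (binomial_lower_tail n w (cdf M a))"
    using E(1) by (simp add: P.emeasure_eq_measure cdf_def)
  ultimately show ?thesis
    using \<open>0 \<le> c\<close> by (simp add: cost_profiles_def ennreal_mult')
qed

section \<open>The expected payment from above\<close>

text \<open>By linearity only the marginals matter: an offer \<open>x\<close> is accepted with
  probability \<open>cdf M x\<close> and then costs \<open>x \<le> c\<close>.\<close>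

lemma expected_total_payment_le:
  assumes "real_distribution M" and "finite (set_pmf D)" and "set_pmf D \<subseteq> {0..c}"
  shows "expected_total_payment M n D
         \<le> ennreal (real n * c * measure_pmf.expectation D (cdf M))"
proof -
  interpret real_distribution M by fact
  let ?P = "Pi\<^sub>M {..<n} (\<lambda>_. M)"
  let ?Q = "Pi_pmf {..<n} 0 (\<lambda>_. D)"
  define g where "g = (\<lambda>t. \<integral>\<^sup>+ x. ennreal (player_payment x t) \<partial>D)"
  have g_eq: "g t = (\<Sum>x\<in>set_pmf D. ennreal x * pmf D x * indicator {..x} t)" for t
    unfolding g_def nn_integral_measure_pmf_finite[OF assms(2) zero_le]
    by (intro sum.cong refl) (simp add: player_payment_def indicator_def)
  have g_meas: "g \<in> borel_measurable M" unfolding g_eq[abs_def] by measurable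
  have inner: "(\<integral>\<^sup>+ p. ennreal (\<Sum>i<n. player_payment (p i) (v i)) \<partial>?Q) = (\<Sum>i<n. g (v i))" for v
  proof -
    have "(\<integral>\<^sup>+ p. ennreal (\<Sum>i<n. player_payment (p i) (v i)) \<partial>?Q)
        = (\<integral>\<^sup>+ p. (\<Sum>i<n. ennreal (player_payment (p i) (v i))) \<partial>?Q)"
    \<comment> \<open>\<open>ennreal\<close> truncates at 0, so it commutes with the sum only for
      nonnegative payments; this holds for prices in the support of \<open>D\<close>.\<close>
    proof (rule nn_integral_cong_AE, rule AE_pmfI)
      fix p assume "p \<in> set_pmf ?Q"
      then have "0 \<le> player_payment (p i) (v i)" if "i < n" for i
        using that assms(3) by (force simp: set_Pi_pmf PiE_dflt_def player_payment_def)
      then show "ennreal (\<Sum>i<n. player_payment (p i) (v i)) = (\<Sum>i<n. ennreal (player_payment (p i) (v i)))"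
        by (intro sum_ennreal[symmetric]) auto
    qed
    also have "\<dots> = (\<Sum>i<n. \<integral>\<^sup>+ p. ennreal (player_payment (p i) (v i)) \<partial>?Q)"
      by (rule nn_integral_sum) simp
    also have "\<dots> = (\<Sum>i<n. g (v i))"
    proof (rule sum.cong[OF refl])
      fix i assume "i \<in> {..<n}"
      then have "map_pmf (\<lambda>p. p i) ?Q = D" by (simp add: Pi_pmf_component)
      moreover have "(\<integral>\<^sup>+ x. ennreal (player_payment x (v i)) \<partial>map_pmf (\<lambda>p. p i) ?Q)
          = (\<integral>\<^sup>+ p. ennreal (player_payment (p i) (v i)) \<partial>?Q)"
        by (rule nn_integral_map_pmf)
      ultimately show "(\<integral>\<^sup>+ p. ennreal (player_payment (p i) (v i)) \<partial>?Q) = g (v i)"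
        by (simp add: g_def)
    qed
    finally show ?thesis .
  qed
  have "expected_total_payment M n D = (\<integral>\<^sup>+ v. (\<Sum>i<n. g (v i)) \<partial>?P)"
    unfolding expected_total_payment_def cost_profiles_def inner ..
  also have "\<dots> = (\<Sum>i<n. \<integral>\<^sup>+ v. g (v i) \<partial>?P)"
    by (intro nn_integral_sum measurable_compose[OF _ g_meas] measurable_component_singleton)
  also have "\<dots> = (\<Sum>i<n. \<integral>\<^sup>+ t. g t \<partial>M)"
  proof (rule sum.cong[OF refl])
    fix i assume "i \<in> {..<n}"
    then have "distr ?P M (\<lambda>v. v i) = M" by (intro distr_PiM_component prob_space_axioms)
    then have "(\<integral>\<^sup>+ t. g t \<partial>M) = (\<integral>\<^sup>+ t. g t \<partial>distr ?P M (\<lambda>v. v i))" by simp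
    also have "\<dots> = (\<integral>\<^sup>+ v. g (v i) \<partial>?P)"
      using g_meas \<open>i \<in> {..<n}\<close> by (intro nn_integral_distr) auto
    finally show "(\<integral>\<^sup>+ v. g (v i) \<partial>?P) = (\<integral>\<^sup>+ t. g t \<partial>M)" ..
  qed
  also have "(\<integral>\<^sup>+ t. g t \<partial>M) = (\<Sum>x\<in>set_pmf D. ennreal (x * pmf D x * cdf M x))"
  proof -
    have "(\<integral>\<^sup>+ t. g t \<partial>M) = (\<Sum>x\<in>set_pmf D. ennreal x * pmf D x * emeasure M {..x})"
      unfolding g_eq[abs_def] by (simp add: nn_integral_sum nn_integral_cmult_indicator)
    then show ?thesis
      using assms(3) by (simp add: emeasure_eq_measure cdf_def2 ennreal_mult'' subset_iff cong: sum.cong)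
  qed
  also have "(\<Sum>i<n. \<Sum>x\<in>set_pmf D. ennreal (x * pmf D x * cdf M x))
      = ennreal (real n * (\<Sum>x\<in>set_pmf D. x * pmf D x * cdf M x))"
    using assms(3) by (subst sum_ennreal) (auto simp: ennreal_mult' cdf_nonneg ennreal_of_nat_eq_real_of_nat)
  also have "\<dots> \<le> ennreal (real n * (c * (\<Sum>x\<in>set_pmf D. pmf D x * cdf M x)))"
    unfolding sum_distrib_left[of c] mult.assoc using assms(3)
    by (intro ennreal_leI mult_left_mono sum_mono mult_right_mono) (auto simp: cdf_nonneg)
  also have "(\<Sum>x\<in>set_pmf D. pmf D x * cdf M x) = measure_pmf.expectation D (cdf M)"
    using assms(2) by (simp add: integral_measure_pmf)
  finally show ?thesis by (simp add: mult.assoc)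
qed

section \<open>The approximation ratio\<close>

theorem theorem4p3:
  fixes M :: "real measure" and n w :: nat and D :: "real pmf"
  assumes "real_distribution M" and "AE x in M. 0 \<le> x"
    and "1 \<le> w" and "w < n"
    and "(\<exists>\<alpha>. cdf M \<alpha> = real w / real n) \<or>
         (discrete_distribution M \<and> (\<nexists>\<alpha>. cdf M \<alpha> = real w / real n) \<and>
          (\<exists>a. is_alpha_minus M (real w / real n) a) \<and>
          (\<exists>b. is_alpha_plus M (real w / real n) b))"
    and "mechanism1_offer M n w D"
  shows "expected_total_payment M n D \<le> 2 * envy_free_benchmark M n w"
proof -
  interpret real_distribution M by fact
  have n: "0 < real n" and w: "0 < real w" using assms(3,4) by auto
  define q where "q = real w / real n"
  have "0 < q" using n w by (simp add: q_def)
  have nonneg: "0 \<le> x" if "0 < measure M A" "A \<in> sets M" "A \<subseteq> {..x}" for A x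
  proof (rule ccontr)
    assume "\<not> 0 \<le> x"
    with that(3) have "AE y in M. y \<notin> A" using assms(2) by (auto elim!: eventually_mono)
    then show False using that prob_eq_0[of A] by simp
  qed
  obtain a c where "0 \<le> c" and a: "0 \<le> cdf M a" "cdf M a \<le> q" and gap: "AE x in M. a < x \<longrightarrow> c \<le> x"
    and D: "finite (set_pmf D)" "set_pmf D \<subseteq> {0..c}" "measure_pmf.expectation D (cdf M) = q"
    using assms(6)
  proof cases
    case (exact \<alpha>)
    have "0 \<le> \<alpha>" using nonneg[of "{..\<alpha>}" \<alpha>] exact \<open>0 < q\<close> by (simp add: cdf_def q_def)
    then show ?thesis using exact by (intro that[of \<alpha> \<alpha>]) (auto simp: cdf_nonneg q_def)
  next
    case (mixed a b \<beta>)
    note am = mixed(3)[unfolded is_alpha_minus_def, folded q_def]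
    note bp = mixed(4)[unfolded is_alpha_plus_def, folded q_def]
    have "a \<le> b" using am bp cdf_nondecreasing[of b a] by linarith
    have "0 \<le> a" using nonneg[of "{a}" a] am by (simp add: support_values_def)
    \<comment> \<open>The last equation says that the mixture with weights \<open>\<beta>\<close>
      and \<open>1 - \<beta>\<close> is accepted with average probability \<open>q\<close>.\<close>
    have \<beta>: "0 \<le> \<beta>" "\<beta> \<le> 1" "\<beta> * (cdf M b - cdf M a) = q - cdf M a"
      using am bp mixed(5)[folded q_def] by simp_all
    obtain S where S: "countable S" "AE x in M. x \<in> S"
      using assms(5) mixed(2) by (auto simp: discrete_distribution_def)
    \<comment> \<open>Countably many points without mass are avoided simultaneously, so almost every
      cost is a support value. Such a value above \<open>a\<close> has \<open>cdf\<close> greater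
      than \<open>q\<close> by maximality of \<open>a\<close>, and is then at least \<open>b\<close>
      by minimality of \<open>b\<close>.\<close>
    have "AE x in M. \<forall>y\<in>S. measure M {y} = 0 \<longrightarrow> x \<noteq> y"
      unfolding AE_ball_countable[OF S(1)]
    proof
      fix y
      show "AE x in M. measure M {y} = 0 \<longrightarrow> x \<noteq> y" using prob_eq_0[of "{y}"] by auto
    qed
    with S(2) have "AE x in M. a < x \<longrightarrow> b \<le> x"
    proof eventually_elim
      case (elim x)
      then have "x \<in> support_values M"
        by (auto simp: support_values_def zero_less_measure_iff)
      moreover have "cdf M x \<noteq> q" using mixed(2) by (auto simp: q_def)
      ultimately show ?case using am bp by (meson linorder_neq_iff not_le)
    qed
    moreover have "measure_pmf.expectation D (cdf M) = q"
      using \<beta> mixed(1) by (simp add: algebra_simps)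
    moreover have "finite (set_pmf D)" "set_pmf D \<subseteq> {0..b}"
      using \<open>0 \<le> a\<close> \<open>a \<le> b\<close> mixed(1) by auto
    ultimately show ?thesis
      using \<open>0 \<le> a\<close> \<open>a \<le> b\<close> am by (intro that[of b a]) (auto simp: cdf_nonneg)
  qed
  have "expected_total_payment M n D \<le> ennreal (real n * c * q)"
    using expected_total_payment_le[OF assms(1) D(1,2)] D(3) by simp
  \<comment> \<open>The payment bound \<open>w * c\<close> is written with a factor 1/2, to be
    replaced by the tail.\<close>
  also have "real n * c * q = 2 * (real w * (c * (1 / 2)))"
    using n by (simp add: q_def)
  also have "ennreal \<dots> \<le> ennreal (2 * (real w * (c * binomial_lower_tail n w (cdf M a))))"
    using \<open>0 \<le> c\<close> binomial_lower_tail_ge_half[OF assms(4) a[unfolded q_def]]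
    by (intro ennreal_leI mult_left_mono) auto
  also have "\<dots> = 2 * (of_nat w * ennreal (c * binomial_lower_tail n w (cdf M a)))"
    by (simp add: ennreal_mult' ennreal_of_nat_eq_real_of_nat)
  also have "\<dots> \<le> 2 * envy_free_benchmark M n w"
    unfolding envy_free_benchmark_def
    using expected_sorted_cost_ge[OF assms(1,4) \<open>0 \<le> c\<close> gap] by (intro mult_left_mono) auto
  finally show ?thesis .
qed

end
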